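(* Let $(X,\to,0,1)$ be an implicative-orthomodular algebra and let $F\subseteq X$. Then $F$ is a commutative deductive system of $X$ if and only if the following conditions hold for all $x,y,z\in X$: (1) $1\in F$; (2) $z\to (y\to x)\in F$ and $z\in F$ imply $(x\Cup y)\to x\in F$.
   Context: A BE algebra is an algebra $(X,\to,1)$ of type $(2,0)$ such that for all $x,y,z\in X$: $x\to x=1$; $x\to 1=1$; $1\to x=x$; $x\to(y\to z)=y\to(x\to z)$. Put $x\le y$ iff $x\to y=1$. It is bounded if there is $0\in X$ with $0\le x$ for all $x\in X$; then $x^*:=x\to 0$. It is involutive if it is bounded and $x^{**}=x$ for all $x$. In an involutive BE algebra $(X,\to,0,1)$ define $x\Cup y:=(x\to y)\to y$ and $x\Cap y:=((x^*\to y^* )\to y^* )^*$. An implicative-orthomodular algebra is an involutive BE algebra satisfying $x\Cap(y\to x)=x$ for all $x,y\in X$. A deductive system of $X$ is a subset $F\subseteq X$ with $1\in F$ and such that $x,\,x\to y\in F$ implies $y\in F$. A deductive system $F$ is commutative if for all $x,y\in X$, $y\to x\in F$ implies $(x\Cup y)\to x\in F$. *)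

theory Defs
  imports Main
begin

locale BE_algebra =
  fixes X :: "'a set"
    and imp :: "'a \<Rightarrow> 'a \<Rightarrow> 'a" (infixr \<open>\<rightarrow>\<close> 65)
    and one :: 'a (\<open>\<one>\<close>)
  assumes imp_closed: "x \<in> X \<Longrightarrow> y \<in> X \<Longrightarrow> x \<rightarrow> y \<in> X"
    and one_closed: "\<one> \<in> X"
    and imp_self: "x \<in> X \<Longrightarrow> x \<rightarrow> x = \<one>"
    and imp_one: "x \<in> X \<Longrightarrow> x \<rightarrow> \<one> = \<one>"
    and one_imp: "x \<in> X \<Longrightarrow> \<one> \<rightarrow> x = x"
    and exchange: "x \<in> X \<Longrightarrow> y \<in> X \<Longrightarrow> z \<in> X \<Longrightarrow> x \<rightarrow> (y \<rightarrow> z) = y \<rightarrow> (x \<rightarrow> z)"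
begin

definition le :: "'a \<Rightarrow> 'a \<Rightarrow> bool" (infix \<open>\<preceq>\<close> 50)
  where "x \<preceq> y \<longleftrightarrow> x \<rightarrow> y = \<one>"

definition deductive_system :: "'a set \<Rightarrow> bool"
  where "deductive_system F \<longleftrightarrow>
    F \<subseteq> X \<and> \<one> \<in> F \<and> (\<forall>x\<in>X. \<forall>y\<in>X. x \<in> F \<longrightarrow> x \<rightarrow> y \<in> F \<longrightarrow> y \<in> F)"

end

locale bounded_BE_algebra = BE_algebra +
  fixes zero :: 'a (\<open>\<zero>\<close>)
  assumes zero_closed: "\<zero> \<in> X"
    and zero_le: "x \<in> X \<Longrightarrow> \<zero> \<preceq> x"
begin

definition star :: "'a \<Rightarrow> 'a" (\<open>_\<^sup>*\<close> [1000] 999)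
  where "x\<^sup>* = x \<rightarrow> \<zero>"

end

locale involutive_BE_algebra = bounded_BE_algebra +
  assumes star_star: "x \<in> X \<Longrightarrow> (x\<^sup>*)\<^sup>* = x"
begin

definition Cup :: "'a \<Rightarrow> 'a \<Rightarrow> 'a" (infixl \<open>\<Cup>\<close> 70)
  where "x \<Cup> y = (x \<rightarrow> y) \<rightarrow> y"

definition Cap :: "'a \<Rightarrow> 'a \<Rightarrow> 'a" (infixl \<open>\<Cap>\<close> 70)
  where "x \<Cap> y = ((x\<^sup>* \<rightarrow> y\<^sup>*) \<rightarrow> y\<^sup>*)\<^sup>*"

definition commutative_deductive_system :: "'a set \<Rightarrow> bool"
  where "commutative_deductive_system F \<longleftrightarrow>
    deductive_system F \<and> (\<forall>x\<in>X. \<forall>y\<in>X. y \<rightarrow> x \<in> F \<longrightarrow> (x \<Cup> y) \<rightarrow> x \<in> F)"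

end

locale implicative_orthomodular_algebra = involutive_BE_algebra +
  assumes orthomodular: "x \<in> X \<Longrightarrow> y \<in> X \<Longrightarrow> x \<Cap> (y \<rightarrow> x) = x"

end

theory Submission
  imports Defs
begin

text \<open>
  The three-variable rule is modus ponens and commutativity merged into one, so the forward direction
  composes the two. They are recovered from the rule by specialising to the unit \<open>\<one>\<close>.
  For \<open>z = \<one>\<close> the premise \<open>z \<rightarrow> (y \<rightarrow> x) \<in> F\<close> becomes
  \<open>y \<rightarrow> x \<in> F\<close>, which is commutativity. For \<open>y = \<one>\<close> the inner implication
  \<open>y \<rightarrow> x\<close> becomes \<open>x\<close>, and the conclusion collapses to \<open>x \<in> F\<close>
  because \<open>x \<Cup> \<one> = \<one>\<close>, which is modus ponens.
\<close>

context involutive_BE_algebra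
begin

lemma Cup_one: "x \<in> X \<Longrightarrow> x \<Cup> \<one> = \<one>"
  by (simp add: Cup_def imp_one one_closed imp_closed)

lemma commutative_deductive_system_iff:
  assumes "F \<subseteq> X"
  shows "commutative_deductive_system F \<longleftrightarrow>
    \<one> \<in> F \<and>
    (\<forall>x\<in>X. \<forall>y\<in>X. \<forall>z\<in>X. z \<rightarrow> (y \<rightarrow> x) \<in> F \<and> z \<in> F \<longrightarrow> (x \<Cup> y) \<rightarrow> x \<in> F)"
    (is "_ \<longleftrightarrow> _ \<and> ?rule")
proof
  assume "commutative_deductive_system F"
  then show "\<one> \<in> F \<and> ?rule"
    unfolding commutative_deductive_system_def deductive_system_def
    by (meson imp_closed)
next
  assume A: "\<one> \<in> F \<and> ?rule"
  have "y \<in> F" if "x \<in> X" "y \<in> X" "x \<in> F" "x \<rightarrow> y \<in> F" for x y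
  proof -
    have "x \<rightarrow> (\<one> \<rightarrow> y) \<in> F"
      using that by (simp add: one_imp)
    then have "(y \<Cup> \<one>) \<rightarrow> y \<in> F"
      using A that one_closed by blast
    then show ?thesis
      using that by (simp add: Cup_one one_imp)
  qed
  moreover have "(x \<Cup> y) \<rightarrow> x \<in> F" if "x \<in> X" "y \<in> X" "y \<rightarrow> x \<in> F" for x y
  proof -
    have "\<one> \<rightarrow> (y \<rightarrow> x) \<in> F"
      using that by (simp add: one_imp imp_closed)
    then show ?thesis
      using A that one_closed by blast
  qed
  ultimately show "commutative_deductive_system F"
    unfolding commutative_deductive_system_def deductive_system_def
    using A assms by blast
qed

end

theorem proposition4p13:
  fixes X F :: "'a set"
    and imp :: "'a \<Rightarrow> 'a \<Rightarrow> 'a" (infixr \<open>\<rightarrow>\<close> 65)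
    and zero one :: 'a
  assumes "implicative_orthomodular_algebra X imp one zero"
    and "F \<subseteq> X"
  shows "involutive_BE_algebra.commutative_deductive_system X imp one F \<longleftrightarrow>
    one \<in> F \<and>
    (\<forall>x\<in>X. \<forall>y\<in>X. \<forall>z\<in>X. z \<rightarrow> (y \<rightarrow> x) \<in> F \<and> z \<in> F \<longrightarrow>
      involutive_BE_algebra.Cup imp x y \<rightarrow> x \<in> F)"
proof -
  interpret implicative_orthomodular_algebra X imp one zero
    by (fact assms(1))
  show ?thesis
    by (rule commutative_deductive_system_iff) (fact assms(2))
qed

end
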